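(* Let $\alpha>0$ and $\beta>0$. The probability density function $x\mapsto f(x\mid\alpha,\beta)$ of the unit-Gompertz distribution $UG(\alpha,\beta)$ is log-concave and unimodal for $x\in\left(0,\ \min\left((\alpha\beta)^{1/\beta},\,1\right)\right]$.
   Context: The unit-Gompertz distribution $UG(\alpha,\beta)$ with shape parameter $\alpha>0$ and scale parameter $\beta>0$ is the distribution supported on $(0,1)$ with probability density function $$f(x\mid\alpha,\beta)=\frac{\alpha\beta\exp\left[-\alpha\left(1/x^{\beta}-1\right)\right]}{x^{1+\beta}},\qquad x\in(0,1).$$ At the right endpoint $x=1$ the density is given by the same formula, so $f(1\mid\alpha,\beta)=\alpha\beta$. Log-concave on an interval means that $\log f$ is a concave function on that interval. Unimodal on an interval means that there is a point of the interval such that $f$ is nondecreasing on the part of the interval to the left of that point and nonincreasing on the part to the right of it. *)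

theory Defs
  imports "HOL-Analysis.Analysis"
begin

text \<open>
  Density of the unit-Gompertz distribution with shape \<open>\<alpha>\<close> and scale \<open>\<beta>\<close>. The
  support is \<open>(0,1)\<close>; at the endpoint \<open>x = 1\<close> the density is given by the same formula,
  hence the half-open condition.
\<close>
definition unit_gompertz_density :: "real \<Rightarrow> real \<Rightarrow> real \<Rightarrow> real" where
  "unit_gompertz_density \<alpha> \<beta> x =
     (if 0 < x \<and> x \<le> 1
      then \<alpha> * \<beta> * exp (- \<alpha> * (1 / x powr \<beta> - 1)) / x powr (1 + \<beta>)
      else 0)"

text \<open>
  Positivity is required explicitly because \<^const>\<open>ln\<close> is total on the reals, while
  \<open>log f\<close> is meaningful only where \<open>f\<close> is positive.
\<close>
definition log_concave_on :: "real set \<Rightarrow> (real \<Rightarrow> real) \<Rightarrow> bool" where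
  "log_concave_on S f \<longleftrightarrow> (\<forall>x\<in>S. 0 < f x) \<and> concave_on S (\<lambda>x. ln (f x))"

definition unimodal_on :: "real set \<Rightarrow> (real \<Rightarrow> real) \<Rightarrow> bool" where
  "unimodal_on S f \<longleftrightarrow>
     (\<exists>m\<in>S. mono_on (S \<inter> {..m}) f \<and> antimono_on (S \<inter> {m..}) f)"

end

(* The log-density g(x) = ln (a b) - a (x^-b - 1) - (1 + b) ln x satisfies
   x g'(x) = a b x^-b - (1 + b) and x^2 g''(x) = (1 + b) (1 - a b x^-b).
   Hence g'' <= 0 exactly when x^b <= a b, which gives log-concavity, and g' changes sign once,
   from + to -, at x^b = a b / (1 + b), which gives the mode (cut off at the right endpoint). *)

theory Submission
  imports Defs
begin

text \<open>The formula has no cut-off at 1, so it is differentiable at every positive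
  \<open>x\<close>. At \<open>x = 1\<close> the density itself may jump to 0, and a two-sided
  derivative would fail there.\<close>

definition unit_gompertz_log_density :: "real \<Rightarrow> real \<Rightarrow> real \<Rightarrow> real" where
  "unit_gompertz_log_density \<alpha> \<beta> x =
     ln (\<alpha> * \<beta>) - \<alpha> * (x powr - \<beta> - 1) - (1 + \<beta>) * ln x"

text \<open>This carries results back to the density: \<open>exp\<close> is positive and increasing,
  and \<open>ln\<close> undoes it.\<close>

lemma unit_gompertz_density_eq_exp:
  assumes "\<alpha> > 0" "\<beta> > 0" "0 < x" "x \<le> 1"
  shows "unit_gompertz_density \<alpha> \<beta> x = exp (unit_gompertz_log_density \<alpha> \<beta> x)"
proof -
  have "exp ((1 + \<beta>) * ln x) = x powr (1 + \<beta>)"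
    using assms by (simp add: powr_def)
  then show ?thesis
    using assms
    by (simp add: unit_gompertz_density_def unit_gompertz_log_density_def exp_diff exp_minus
        powr_minus_divide divide_inverse)
qed

lemma DERIV_unit_gompertz_log_density:
  assumes "0 < x"
  shows "(unit_gompertz_log_density \<alpha> \<beta> has_real_derivative
           (\<alpha> * \<beta> * x powr - \<beta> - (1 + \<beta>)) / x) (at x)"
  unfolding unit_gompertz_log_density_def
  by (rule derivative_eq_intros refl | use assms in \<open>simp add: powr_diff field_simps\<close>)+

lemma DERIV2_unit_gompertz_log_density:
  assumes "0 < x"
  shows "((\<lambda>x. (\<alpha> * \<beta> * x powr - \<beta> - (1 + \<beta>)) / x) has_real_derivative
           (1 + \<beta>) * (1 - \<alpha> * \<beta> * x powr - \<beta>) / x\<^sup>2) (at x)"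
  by (rule derivative_eq_intros refl
      | use assms in \<open>simp add: powr_diff field_simps power2_eq_square\<close>)+

text \<open>For \<open>b > 0\<close> the map \<open>x powr b\<close> is strictly increasing, and it
  sends \<open>a powr (1 / b)\<close> to \<open>a\<close>. It is used with \<open>a\<close> equal to
  \<open>\<alpha> * \<beta>\<close> for the endpoint and
  \<open>\<alpha> * \<beta> / (1 + \<beta>)\<close> for the mode.\<close>

lemma powr_le_iff_le_powr_inverse:
  fixes a b x :: real
  assumes "a > 0" "b > 0" "x > 0"
  shows "x powr b \<le> a \<longleftrightarrow> x \<le> a powr (1 / b)"
proof -
  have "x powr b \<le> (a powr (1 / b)) powr b \<longleftrightarrow> x \<le> a powr (1 / b)"
    using assms powr_mono2[of b x "a powr (1 / b)"] powr_less_mono2[of b "a powr (1 / b)" x]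
    by (auto simp del: powr_powr simp flip: not_less)
  then show ?thesis
    using assms by (simp add: powr_powr)
qed

lemma log_concave_on_unit_gompertz_density:
  assumes "\<alpha> > 0" "\<beta> > 0"
  shows "log_concave_on {0<..min ((\<alpha> * \<beta>) powr (1 / \<beta>)) 1} (unit_gompertz_density \<alpha> \<beta>)"
    (is "log_concave_on ?S _")
proof -
  have "concave_on ?S (unit_gompertz_log_density \<alpha> \<beta>)"
  proof (rule f''_le0_imp_concave)
    fix x assume x: "x \<in> ?S"
    have "x powr \<beta> \<le> \<alpha> * \<beta>"
      using x assms by (simp add: powr_le_iff_le_powr_inverse)
    then have "1 - \<alpha> * \<beta> * x powr - \<beta> \<le> 0"
      using x by (simp add: powr_minus field_simps)
    then show "(1 + \<beta>) * (1 - \<alpha> * \<beta> * x powr - \<beta>) / x\<^sup>2 \<le> 0"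
      using assms by (simp add: divide_nonpos_nonneg mult_nonneg_nonpos)
  qed (auto intro: DERIV_unit_gompertz_log_density DERIV2_unit_gompertz_log_density)
  \<comment> \<open>The two functions agree only inside the interval, so convex combinations must be
    known to stay there; \<open>convex_def\<close> exposes this.\<close>
  then have "concave_on ?S (\<lambda>x. ln (unit_gompertz_density \<alpha> \<beta> x))"
    using assms by (simp add: concave_on_iff unit_gompertz_density_eq_exp convex_def)
  then show ?thesis
    using assms by (simp add: log_concave_on_def unit_gompertz_density_eq_exp)
qed

text \<open>The argument rests on the sign of the first derivative alone, not on concavity, hence
  the general endpoint \<open>c\<close>.\<close>

lemma unimodal_on_unit_gompertz_density:
  assumes "\<alpha> > 0" "\<beta> > 0" "0 < c" "c \<le> 1"
  shows "unimodal_on {0<..c} (unit_gompertz_density \<alpha> \<beta>)"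
proof -
  \<comment> \<open>The only positive zero of the derivative of the log-density; it may lie beyond
    \<open>c\<close>.\<close>
  define m where "m = (\<alpha> * \<beta> / (1 + \<beta>)) powr (1 / \<beta>)"
  have pos: "\<alpha> * \<beta> / (1 + \<beta>) > 0" using assms by simp
  have sign: "\<alpha> * \<beta> * x powr - \<beta> - (1 + \<beta>) \<ge> 0 \<longleftrightarrow> x \<le> m" if "x > 0" for x
  proof -
    have "x \<le> m \<longleftrightarrow> x powr \<beta> \<le> \<alpha> * \<beta> / (1 + \<beta>)"
      unfolding m_def using assms that pos by (simp only: powr_le_iff_le_powr_inverse)
    then show ?thesis
      using assms that by (simp add: powr_minus field_simps)
  qed
  have inc: "unit_gompertz_log_density \<alpha> \<beta> x \<le> unit_gompertz_log_density \<alpha> \<beta> y"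
    if "0 < x" "x \<le> y" "y \<le> m" for x y
  proof (rule DERIV_nonneg_imp_nondecreasing[OF \<open>x \<le> y\<close>])
    fix z assume "x \<le> z" "z \<le> y"
    then show "\<exists>d. DERIV (unit_gompertz_log_density \<alpha> \<beta>) z :> d \<and> 0 \<le> d"
      using that sign[of z] DERIV_unit_gompertz_log_density[of z \<alpha> \<beta>]
      by (intro exI[of _ "(\<alpha> * \<beta> * z powr - \<beta> - (1 + \<beta>)) / z"]) auto
  qed
  have dec: "unit_gompertz_log_density \<alpha> \<beta> y \<le> unit_gompertz_log_density \<alpha> \<beta> x"
    if "0 < x" "m \<le> x" "x \<le> y" for x y
  \<comment> \<open>At \<open>m\<close> itself \<open>sign\<close> gives only a nonnegative
    derivative. On the open interval \<open>m < z\<close> is strict, so the negation of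
    \<open>sign\<close> applies; continuity covers the endpoints.\<close>
  proof (rule DERIV_nonpos_imp_decreasing_open[OF \<open>x \<le> y\<close>])
    fix z assume "x < z" "z < y"
    then show "\<exists>d. DERIV (unit_gompertz_log_density \<alpha> \<beta>) z :> d \<and> d \<le> 0"
      using that sign[of z] DERIV_unit_gompertz_log_density[of z \<alpha> \<beta>]
      by (intro exI[of _ "(\<alpha> * \<beta> * z powr - \<beta> - (1 + \<beta>)) / z"]) (auto simp: divide_nonpos_pos)
  next
    show "continuous_on {x..y} (unit_gompertz_log_density \<alpha> \<beta>)"
      using that
      by (intro continuous_at_imp_continuous_on ballI
          DERIV_isCont[OF DERIV_unit_gompertz_log_density]) auto
  qed
  have "mono_on ({0<..c} \<inter> {..min m c}) (unit_gompertz_density \<alpha> \<beta>)"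
    using assms inc by (intro mono_onI) (simp add: unit_gompertz_density_eq_exp)
  moreover have "antimono_on ({0<..c} \<inter> {min m c..}) (unit_gompertz_density \<alpha> \<beta>)"
  proof (rule monotone_onI)
    fix x y assume xy: "x \<in> {0<..c} \<inter> {min m c..}" "y \<in> {0<..c} \<inter> {min m c..}" "x \<le> y"
    \<comment> \<open>If \<open>m\<close> exceeds \<open>c\<close>, the set right of
      \<open>min m c\<close> is just the point \<open>c\<close>, which forces
      \<open>x = y\<close>.\<close>
    then have "m \<le> x \<or> x = y"
      by auto
    then show "unit_gompertz_density \<alpha> \<beta> x \<ge> unit_gompertz_density \<alpha> \<beta> y"
      using assms xy dec[of x y] by (auto simp: unit_gompertz_density_eq_exp)
  qed
  moreover have "min m c \<in> {0<..c}"
    using assms pos by (simp add: m_def)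
  ultimately show ?thesis
    unfolding unimodal_on_def by blast
qed

theorem theorem2p1:
  fixes \<alpha> \<beta> :: real
  assumes "\<alpha> > 0" and "\<beta> > 0"
  shows "log_concave_on {0<..min ((\<alpha> * \<beta>) powr (1 / \<beta>)) 1} (unit_gompertz_density \<alpha> \<beta>)
       \<and> unimodal_on {0<..min ((\<alpha> * \<beta>) powr (1 / \<beta>)) 1} (unit_gompertz_density \<alpha> \<beta>)"
  using assms
  by (intro conjI log_concave_on_unit_gompertz_density unimodal_on_unit_gompertz_density) auto

end
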